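(* Let $\pi_k$ denote the $k$-th prime number, where $\pi_1=2$. For each positive integer $n$, the subset $$K_n := \left\{ f\in \mathcal{A} \mid f(1) = 0 \text{ and } f(\pi_k) = 0 \text{ for all } k \geqslant n \right\}$$ is an ideal of $\mathcal{A}$ that is not prime, and $K_1\subseteq K_2\subseteq K_3\subseteq \cdots$ is an infinite ascending chain of ideals. Therefore, the ring $\mathcal{A}$ is not Noetherian.
   Context: $\mathds{N}$ denotes the non-negative integers and $\mathds{N}^+=\mathds{N}\setminus\{0\}$. $\mathcal{A}$ is the ring of arithmetical functions: the set of all functions $f\colon \mathds{N}^+\to\mathds{C}$ with pointwise addition $(f+g)(n)=f(n)+g(n)$ and Dirichlet convolution $(f*g)(n)=\sum_{ij=n}f(i)g(j)$ as multiplication. It is a commutative ring with identity $e$, where $e(1)=1$ and $e(n)=0$ for $n>1$. *)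

theory Defs
  imports
    Complex_Main
    "HOL-Algebra.Ring_Divisibility"
    "HOL-Computational_Algebra.Primes"
    "HOL-Library.FuncSet"
    "HOL-Library.Infinite_Set"
begin

text \<open>
  Functions on the positive integers are represented by functions on \<^typ>\<open>nat\<close> that are
  extensional on \<open>{1..}\<close>, i.e. whose (irrelevant) value at \<open>0\<close> is pinned to
  \<^term>\<open>undefined\<close>; so equality in the carrier is equality on the positive integers.
  For \<open>n > 0\<close>, the pairs \<open>(i, j)\<close> with \<open>i * j = n\<close> are finitely many and
  automatically positive.
\<close>

definition arith_ring :: "(nat \<Rightarrow> complex) ring" where
  "arith_ring =
    \<lparr>carrier = {1..} \<rightarrow>\<^sub>E UNIV,
     mult = (\<lambda>f g. \<lambda>n\<in>{1..}. \<Sum>(i, j) | i * j = n. f i * g j),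
     one = (\<lambda>n\<in>{1..}. if n = 1 then 1 else 0),
     zero = (\<lambda>n\<in>{1..}. 0),
     add = (\<lambda>f g. \<lambda>n\<in>{1..}. f n + g n)\<rparr>"

text \<open>The indexing of primes starts at 1 (while \<^const>\<open>enumerate\<close> starts at 0).\<close>

definition nth_prime :: "nat \<Rightarrow> nat" where
  "nth_prime k = enumerate {p. prime p} (k - 1)"

definition K :: "nat \<Rightarrow> (nat \<Rightarrow> complex) set" where
  "K n = {f \<in> carrier arith_ring. f 1 = 0 \<and> (\<forall>k\<ge>n. f (nth_prime k) = 0)}"

lemma nth_prime_1: "nth_prime 1 = 2"
proof -
  have "(LEAST p::nat. prime p) = 2"
    by (rule Least_equality) (auto simp: prime_ge_2_nat)
  then show ?thesis
    by (simp add: nth_prime_def enumerate_0)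
qed

lemma finite_factor_pairs:
  assumes "n \<ge> (1::nat)"
  shows "finite {(i, j). i * j = n}"
proof (rule finite_subset)
  show "{(i, j). i * j = n} \<subseteq> {..n} \<times> {..n}"
    using assms by (auto intro!: dvd_imp_le)
qed simp

lemma cring_arith_ring: "cring arith_ring"
proof (rule cringI)
  show "abelian_group arith_ring"
  proof (rule abelian_groupI)
    fix f assume f: "f \<in> carrier arith_ring"
    show "\<exists>g\<in>carrier arith_ring. g \<oplus>\<^bsub>arith_ring\<^esub> f = \<zero>\<^bsub>arith_ring\<^esub>"
      by (rule bexI[of _ "\<lambda>n\<in>{1..}. - f n"]) (auto simp: arith_ring_def)
  qed (auto simp: arith_ring_def restrict_def PiE_def extensional_def fun_eq_iff)
next
  have assoc: "(\<Sum>(i, j) | i * j = n. (\<Sum>(a, b) | a * b = i. f a * g b) * h j)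
      = (\<Sum>(i, j) | i * j = n. f i * (\<Sum>(a, b) | a * b = j. g a * h b))"
    if n: "n \<ge> 1" for n and f g h :: "nat \<Rightarrow> complex"
  proof -
    have pos: "i \<ge> 1 \<and> j \<ge> 1" if "i * j = n" for i j
      using that n by (cases i; cases j) auto
    have "(\<Sum>(i, j) | i * j = n. (\<Sum>(a, b) | a * b = i. f a * g b) * h j)
        = (\<Sum>p\<in>{(i, j). i * j = n}. \<Sum>q\<in>{(a, b). a * b = fst p}.
             f (fst q) * g (snd q) * h (snd p))"
      by (simp add: sum_distrib_right case_prod_unfold)
    also have "\<dots> = (\<Sum>(p, q)\<in>Sigma {(i, j). i * j = n} (\<lambda>p. {(a, b). a * b = fst p}).
             f (fst q) * g (snd q) * h (snd p))"
      by (rule sum.Sigma) (use n pos in \<open>auto intro!: finite_factor_pairs\<close>)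
    also have "\<dots> = (\<Sum>(p, q)\<in>Sigma {(i, j). i * j = n} (\<lambda>p. {(a, b). a * b = snd p}).
             f (fst p) * (g (fst q) * h (snd q)))"
      by (rule sum.reindex_bij_witness[where
            i = "\<lambda>((i, _), (a, b)). ((i * a, b), (i, a))" and
            j = "\<lambda>((_, j), (a, b)). ((a, b * j), (b, j))"])
         (auto simp: mult_ac)
    also have "\<dots> = (\<Sum>p\<in>{(i, j). i * j = n}. \<Sum>q\<in>{(a, b). a * b = snd p}.
             f (fst p) * (g (fst q) * h (snd q)))"
      by (rule sum.Sigma[symmetric]) (use n pos in \<open>auto intro!: finite_factor_pairs\<close>)
    also have "\<dots> = (\<Sum>(i, j) | i * j = n. f i * (\<Sum>(a, b) | a * b = j. g a * h b))"
      by (simp add: sum_distrib_left case_prod_unfold)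
    finally show ?thesis .
  qed
  have restr_left: "(\<Sum>(i, j) | i * j = n. (if i \<ge> 1 then F i else undefined) * G j)
      = (\<Sum>(i, j) | i * j = n. F i * G j)"
    and restr_right: "(\<Sum>(i, j) | i * j = n. G i * (if j \<ge> 1 then F j else undefined))
      = (\<Sum>(i, j) | i * j = n. G i * F j)"
    if "n \<ge> 1" for n and F G :: "nat \<Rightarrow> complex"
    using that by (auto intro!: sum.cong simp: Suc_le_eq)
  have comm: "(\<Sum>(i, j) | i * j = n. f i * g j) = (\<Sum>(i, j) | i * j = n. g i * f j)"
    for n and f g :: "nat \<Rightarrow> complex"
    by (rule sum.reindex_bij_witness[where i = "\<lambda>(i, j). (j, i)" and j = "\<lambda>(i, j). (j, i)"])
       (auto simp: mult_ac)
  have unit: "(\<Sum>(i, j) | i * j = n. (if i = 1 then 1 else 0) * f j) = f n"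
    if "n \<ge> 1" for n and f :: "nat \<Rightarrow> complex"
  proof -
    have "(\<Sum>(i, j) | i * j = n. (if i = 1 then 1 else 0) * f j)
        = (\<Sum>(i, j)\<in>{(1::nat, n)}. (if i = 1 then 1 else 0) * f j)"
      by (rule sum.mono_neutral_right)
         (use that in \<open>auto intro!: finite_factor_pairs split: if_splits\<close>)
    then show ?thesis by simp
  qed
  show "comm_monoid arith_ring"
  proof (rule comm_monoidI)
    fix f g h :: "nat \<Rightarrow> complex"
    show "f \<otimes>\<^bsub>arith_ring\<^esub> g \<otimes>\<^bsub>arith_ring\<^esub> h = f \<otimes>\<^bsub>arith_ring\<^esub> (g \<otimes>\<^bsub>arith_ring\<^esub> h)"
      by (rule ext) (simp add: arith_ring_def restrict_def restr_left[simplified]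
          restr_right[simplified] assoc[simplified])
    show "f \<otimes>\<^bsub>arith_ring\<^esub> g = g \<otimes>\<^bsub>arith_ring\<^esub> f"
      by (simp add: arith_ring_def comm[of f g])
  next
    fix f assume "f \<in> carrier arith_ring"
    then show "\<one>\<^bsub>arith_ring\<^esub> \<otimes>\<^bsub>arith_ring\<^esub> f = f"
      by (intro ext) (auto simp: arith_ring_def restrict_def restr_left[simplified]
          unit[simplified] PiE_def extensional_def)
  qed (auto simp: arith_ring_def)
next
  fix f g h :: "nat \<Rightarrow> complex"
  have "(\<Sum>(i, j) | i * j = n. (if i \<ge> 1 then f i + g i else undefined) * h j)
      = (\<Sum>(i, j) | i * j = n. f i * h j) + (\<Sum>(i, j) | i * j = n. g i * h j)"
    if "n \<ge> 1" for n
    unfolding sum.distrib[symmetric]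
    using that by (intro sum.cong) (auto simp: Suc_le_eq algebra_simps)
  then show "(f \<oplus>\<^bsub>arith_ring\<^esub> g) \<otimes>\<^bsub>arith_ring\<^esub> h
      = f \<otimes>\<^bsub>arith_ring\<^esub> h \<oplus>\<^bsub>arith_ring\<^esub> g \<otimes>\<^bsub>arith_ring\<^esub> h"
    by (intro ext) (simp add: arith_ring_def restrict_def)
qed

end

theory Submission
  imports Defs
begin

text \<open>
  Only the values at \<open>1\<close> and at the primes matter, and there convolution is transparent:
  \<open>(f * g)(1) = f(1) g(1)\<close> and \<open>(f * g)(p) = f(1) g(p) + f(p) g(1)\<close>, because \<open>p\<close> has no other
  factorisations (\<open>dirichlet_at_one\<close>, \<open>dirichlet_at_prime\<close>).  Thus \<open>f \<mapsto> f(1)\<close> is a ring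
  homomorphism to the complex numbers and \<open>f \<mapsto> f(p)\<close> is a derivation over it.

  All of the claims follow.  If \<open>f(1) = 0\<close> then \<open>(f * g)(p) = f(p) g(1)\<close>, which vanishes whenever
  \<open>f(p)\<close> does, so every \<^term>\<open>K n\<close> is an ideal.  If also \<open>g(1) = 0\<close> then \<open>f * g\<close> vanishes at all
  primes, so \<^term>\<open>K n\<close> contains the square of the indicator function of the \<open>n\<close>th prime,
  although it does not contain that function itself: it is not prime.  The same indicator function
  lies in \<^term>\<open>K (Suc n)\<close>, which makes the chain strictly increasing; in a Noetherian ring
  the union of the chain would be one of its members, and the next member would be no larger.
\<close>

lemma arith_carrier: "f \<in> carrier arith_ring \<longleftrightarrow> f \<in> {1..} \<rightarrow>\<^sub>E UNIV"
  and arith_add: "n \<ge> 1 \<Longrightarrow> (f \<oplus>\<^bsub>arith_ring\<^esub> g) n = f n + g n"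
  and arith_zero: "n \<ge> 1 \<Longrightarrow> \<zero>\<^bsub>arith_ring\<^esub> n = 0"
  and arith_mult: "n \<ge> 1 \<Longrightarrow> (f \<otimes>\<^bsub>arith_ring\<^esub> g) n = (\<Sum>(i, j) | i * j = n. f i * g j)"
  by (simp_all add: arith_ring_def)

lemma dirichlet_at_one: "(f \<otimes>\<^bsub>arith_ring\<^esub> g) 1 = f 1 * g 1"
proof -
  have "{(i, j). i * j = (1::nat)} = {(1, 1)}" by auto
  then show ?thesis by (simp add: arith_mult)
qed

lemma dirichlet_at_prime:
  assumes "prime p"
  shows "(f \<otimes>\<^bsub>arith_ring\<^esub> g) p = f 1 * g p + f p * g 1"
proof -
  have p: "p > 1" using assms by (rule prime_gt_1_nat)
  have "i = 1 \<or> j = 1" if "i * j = p" for i j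
  proof -
    have "i = 1 \<or> i = p" using assms that prime_nat_iff[of p] dvd_triv_left[of i j] by blast
    then show ?thesis using that p by auto
  qed
  then have "{(i, j). i * j = p} = {(1, p), (p, 1)}" by fastforce
  then show ?thesis using p by (simp add: arith_mult)
qed

lemma prime_nth_prime: "prime (nth_prime k)"
  using enumerate_in_set[OF primes_infinite, of "k - 1"] by (simp add: nth_prime_def)

lemma nth_prime_gt_1: "nth_prime k > 1"
  by (rule prime_gt_1_nat[OF prime_nth_prime])

text \<open>Truncated subtraction makes \<^term>\<open>nth_prime 0\<close> and \<^term>\<open>nth_prime 1\<close> equal, hence the
  lower bound.\<close>

lemma nth_prime_less:
  assumes "1 \<le> m" "m < k"
  shows "nth_prime m < nth_prime k"
  using assms by (simp add: nth_prime_def enumerate_mono[OF _ primes_infinite])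

lemma K_ideal: "ideal (K n) arith_ring"
proof -
  interpret cring arith_ring by (rule cring_arith_ring)
  have mult: "a \<otimes>\<^bsub>arith_ring\<^esub> x \<in> K n" if "a \<in> K n" "x \<in> carrier arith_ring" for a x
    using that by (simp add: K_def dirichlet_at_prime[OF prime_nth_prime]
        dirichlet_at_one[unfolded One_nat_def])
  show ?thesis
  proof (rule idealI[OF ring_axioms])
    show "subgroup (K n) (add_monoid arith_ring)"
    proof (rule add.subgroupI)
      have "\<zero>\<^bsub>arith_ring\<^esub> \<in> K n"
        using less_imp_le[OF nth_prime_gt_1] by (simp add: K_def arith_zero)
      then show "K n \<noteq> {}" by blast
    next
      fix a assume a: "a \<in> K n"
      then have c: "a \<in> carrier arith_ring" by (simp add: K_def)
      have "\<ominus>\<^bsub>arith_ring\<^esub> a = a \<otimes>\<^bsub>arith_ring\<^esub> (\<ominus>\<^bsub>arith_ring\<^esub> \<one>\<^bsub>arith_ring\<^esub>)"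
        using c by (simp add: r_minus)
      then show "\<ominus>\<^bsub>arith_ring\<^esub> a \<in> K n" using mult[OF a] by simp
    next
      fix a b assume "a \<in> K n" "b \<in> K n"
      then show "a \<oplus>\<^bsub>arith_ring\<^esub> b \<in> K n"
        using less_imp_le[OF nth_prime_gt_1] by (simp add: K_def arith_add)
    qed (simp add: K_def subset_iff)
  next
    fix a x assume a: "a \<in> K n" "x \<in> carrier arith_ring"
    then show "a \<otimes>\<^bsub>arith_ring\<^esub> x \<in> K n" by (rule mult)
    then show "x \<otimes>\<^bsub>arith_ring\<^esub> a \<in> K n" using a by (simp add: K_def m_comm)
  qed
qed

text \<open>Both terms of the product rule at a prime have a factor \<^term>\<open>f 1\<close> or \<^term>\<open>g 1\<close>.  So
  the square of the maximal ideal of functions vanishing at \<open>1\<close> lies in every \<^term>\<open>K n\<close>, and a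
  prime \<^term>\<open>K n\<close> would have to contain that whole maximal ideal.\<close>

lemma mult_in_K:
  assumes "f \<in> carrier arith_ring" "g \<in> carrier arith_ring" "f 1 = 0" "g 1 = 0"
  shows "f \<otimes>\<^bsub>arith_ring\<^esub> g \<in> K n"
proof -
  interpret cring arith_ring by (rule cring_arith_ring)
  show ?thesis
    using assms by (simp add: K_def dirichlet_at_prime[OF prime_nth_prime]
        dirichlet_at_one[unfolded One_nat_def])
qed

definition prime_indicator :: "nat \<Rightarrow> nat \<Rightarrow> complex" where
  "prime_indicator k = (\<lambda>m\<in>{1..}. if m = nth_prime k then 1 else 0)"

lemma prime_indicator_carrier: "prime_indicator k \<in> carrier arith_ring"
  by (simp add: prime_indicator_def arith_carrier)

lemma prime_indicator_at_1: "prime_indicator k 1 = 0"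
  using nth_prime_gt_1[of k] by (simp add: prime_indicator_def)

lemma prime_indicator_not_in_K: "prime_indicator n \<notin> K n"
  using less_imp_le[OF nth_prime_gt_1, of n] by (auto simp: K_def prime_indicator_def)

lemma prime_indicator_in_K_Suc:
  assumes "n \<ge> 1"
  shows "prime_indicator n \<in> K (Suc n)"
proof -
  have "prime_indicator n (nth_prime k) = 0" if "k \<ge> Suc n" for k
    using nth_prime_less[OF assms, of k] less_imp_le[OF nth_prime_gt_1, of k] that
    by (simp add: prime_indicator_def)
  then show ?thesis
    using prime_indicator_carrier prime_indicator_at_1 by (simp add: K_def)
qed

lemma K_not_prime: "\<not> primeideal (K n) arith_ring"
proof
  assume "primeideal (K n) arith_ring"
  then have "prime_indicator n \<in> K n"
    using primeideal.I_prime[of "K n" arith_ring "prime_indicator n" "prime_indicator n"]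
      mult_in_K prime_indicator_carrier prime_indicator_at_1 by blast
  then show False using prime_indicator_not_in_K by contradiction
qed

lemma K_mono: "m \<le> n \<Longrightarrow> K m \<subseteq> K n"
  by (auto simp: K_def)

lemma K_strict:
  assumes "n \<ge> 1"
  shows "K n \<subset> K (Suc n)"
  using K_mono[of n "Suc n"] prime_indicator_in_K_Suc[OF assms] prime_indicator_not_in_K[of n]
  by auto

lemma arith_ring_not_noetherian: "\<not> noetherian_ring arith_ring"
proof
  assume "noetherian_ring arith_ring"
  then interpret noetherian_ring arith_ring .
  have "subset.chain {I. ideal I arith_ring} (K ` {1..})"
    unfolding subset_chain_def using K_ideal K_mono nat_le_linear by blast
  then have "\<Union>(K ` {1..}) \<in> K ` {1..}" by (intro ideal_chain_is_trivial) auto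
  then obtain m where m: "m \<ge> 1" "\<Union>(K ` {1..}) = K m" by auto
  then have "K (Suc m) \<subseteq> K m" by (metis UN_upper atLeast_iff le_SucI)
  with K_strict[OF m(1)] show False by blast
qed

theorem proposition3p21:
  shows "(\<forall>n\<ge>1. ideal (K n) arith_ring \<and> \<not> primeideal (K n) arith_ring)
    \<and> (\<forall>n\<ge>1. K n \<subset> K (Suc n))
    \<and> \<not> noetherian_ring arith_ring"
  using K_ideal K_not_prime K_strict arith_ring_not_noetherian by blast

end
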